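(* Let $q$ be a power of $2$ and let $d_1, d_2, d_3$ be integers with $\frac{q}{2} < d_1, d_2, d_3 \leq q$. Then $$\dim_{\mathbb{F}_2} \frac{\mathbb{F}_2[x,y,z]}{(x^{d_1},\, y^{d_2},\, z^{d_3},\, x+y+z)} = d_1d_2 + d_2d_3 + d_1d_3 - q(d_1+d_2+d_3) + q^2.$$
   Context: $\mathbb{F}_2 = \mathbb{Z}/2\mathbb{Z}$ is the field with two elements, $\mathbb{F}_2[x,y,z]$ is the polynomial ring in three variables, and $\dim_{\mathbb{F}_2}$ denotes dimension as an $\mathbb{F}_2$-vector space. *)

theory Defs
  imports
    "HOL-Library.Z2"
    "HOL-Computational_Algebra.Polynomial"
    "HOL-Algebra.Algebraic_Closure_Type"
begin

text \<open>
  \<^typ>\<open>bit\<close> is the field with two elements, and the polynomial ring in \<open>x, y, z\<close> over it is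
  the iterated polynomial ring \<open>((bit[x])[y])[z]\<close>: the innermost variable is \<open>x\<close>, the outermost
  is \<open>z\<close>.  The type-class ring is turned into a ring record so that the ideals, quotient rings
  and dimensions of HOL-Algebra apply to it.
\<close>

type_synonym F2_xyz = "bit poly poly poly"

definition F2_xyz_ring :: "F2_xyz ring" where
  "F2_xyz_ring = ring_of_type_algebra"

definition const_F2 :: "bit \<Rightarrow> F2_xyz" where
  "const_F2 c = [:[:[:c:]:]:]"

definition var_x :: F2_xyz where
  "var_x = [:[:[:0, 1:]:]:]"

definition var_y :: F2_xyz where
  "var_y = [:[:0, 1:]:]"

definition var_z :: F2_xyz where
  "var_z = [:0, 1:]"

definition xyz_ideal :: "nat \<Rightarrow> nat \<Rightarrow> nat \<Rightarrow> F2_xyz set" where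
  "xyz_ideal d1 d2 d3 =
     Idl\<^bsub>F2_xyz_ring\<^esub> {var_x ^ d1, var_y ^ d2, var_z ^ d3, var_x + var_y + var_z}"

text \<open>
  HOL-Algebra measures dimensions over a subfield of the ambient ring.  For a quotient of the
  polynomial ring by an ideal \<open>I\<close> this subfield consists of the residue classes of the constants;
  for a proper ideal it is a copy of the two-element field, acting on the quotient by the induced
  scalar multiplication.
\<close>

definition scalars_mod :: "F2_xyz set \<Rightarrow> F2_xyz set set" where
  "scalars_mod I = range (\<lambda>c. I +>\<^bsub>F2_xyz_ring\<^esub> const_F2 c)"

text \<open>
  The library's \<open>dim\<close> is unspecified for a space without a finite basis, so a claim about its
  value is meaningful only together with \<open>finite_dim_quot\<close>.
\<close>

definition finite_dim_quot :: "F2_xyz set \<Rightarrow> bool" where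
  "finite_dim_quot I \<longleftrightarrow>
     ring.finite_dimension (F2_xyz_ring Quot I) (scalars_mod I) (carrier (F2_xyz_ring Quot I))"

definition dim_quot :: "F2_xyz set \<Rightarrow> nat" where
  "dim_quot I = ring.dim (F2_xyz_ring Quot I) (scalars_mod I) (carrier (F2_xyz_ring Quot I))"

end

theory Submission
  imports Defs
begin

text \<open>
  Over a finite field dimensions can be read off from cardinalities, and the number of cosets is
  multiplicative: \<open>|R/I| = |R/(I + mR)| \<cdot> |R/(I : m)|\<close>.  Eliminating \<open>z\<close> turns the quotient into
  \<open>F\<^sub>2[x, y]/(x\<^bsup>d1\<^esup>, y\<^bsup>d2\<^esup>, t\<^bsup>d3\<^esup>)\<close> with \<open>t = x + y\<close>, so it suffices to know the colon ideal
  \<open>(x\<^bsup>d1\<^esup>, y\<^bsup>d2\<^esup>) : t\<^bsup>d3\<^esup>\<close>.  For \<open>q > 1\<close> write \<open>q = 2 s\<close>, \<open>d1 = s + a\<close>, \<open>d2 = s + b\<close>, \<open>d3 = 2 s - c\<close>.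
  From \<open>t\<^bsup>s\<^esup> = x\<^bsup>s\<^esup> + y\<^bsup>s\<^esup>\<close> one finds that this colon ideal is the complete intersection
  \<open>(t\<^bsup>c\<^esup>, x\<^bsup>a\<^esup> y\<^bsup>b\<^esup>)\<close>, of colength \<open>c (a + b)\<close>, so the dimension is \<open>d1 d2 - c (a + b)\<close>.
\<close>

section \<open>Cosets and indices of additive subgroups\<close>

definition coset :: "'a::comm_ring_1 set \<Rightarrow> 'a \<Rightarrow> 'a set" where
  "coset I f = (\<lambda>h. h + f) ` I"

text \<open>An infinite index is recorded as 0; since there is always at least one coset, products
  of indices respect this convention.\<close>

definition coset_index :: "'a::comm_ring_1 set \<Rightarrow> nat" where
  "coset_index I = card (range (coset I))"

definition additive_subgroup_set :: "'a::comm_ring_1 set \<Rightarrow> bool" where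
  "additive_subgroup_set I \<longleftrightarrow> 0 \<in> I \<and> (\<forall>f\<in>I. \<forall>g\<in>I. f - g \<in> I)"

lemma coset_eq_iff:
  assumes "additive_subgroup_set I"
  shows "coset I f = coset I g \<longleftrightarrow> f - g \<in> I"
proof -
  have zero: "0 \<in> I" and diff: "\<And>u v. u \<in> I \<Longrightarrow> v \<in> I \<Longrightarrow> u - v \<in> I"
    using assms by (auto simp: additive_subgroup_set_def)
  have minus: "- u \<in> I" if "u \<in> I" for u
    using diff[OF zero that] by simp
  have mem: "u \<in> coset I h \<longleftrightarrow> u - h \<in> I" for u h
    by (auto simp: coset_def image_iff intro: bexI[of _ "u - h"])
  show ?thesis
  proof
    assume "coset I f = coset I g"
    moreover have "f \<in> coset I f" using zero by (simp add: mem)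
    ultimately show "f - g \<in> I" by (simp add: mem)
  next
    assume fg: "f - g \<in> I"
    have "u - f \<in> I \<longleftrightarrow> u - g \<in> I" for u
      using diff[of "u - g" "f - g"] diff[of "u - f" "- (f - g)"] minus[OF fg] fg
      by auto
    then show "coset I f = coset I g" by (auto simp: mem)
  qed
qed

text \<open>Multiplication by \<open>m\<close> embeds R/(I : m) into R/I with cokernel R/(I + mR).
  Concretely, after fixing representatives \<open>rJ\<close> and \<open>rK\<close>, each coset of
  \<open>I\<close> contains \<open>a + m * b\<close> for exactly one pair of
  representatives.\<close>

lemma coset_index_sum_colon:
  assumes "additive_subgroup_set I"
  shows "coset_index I = coset_index {f. \<exists>g. f - m * g \<in> I} * coset_index {f. m * f \<in> I}"
proof -
  define J where "J = {f. \<exists>g. f - m * g \<in> I}"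
  define K where "K = {f. m * f \<in> I}"
  have zero: "0 \<in> I" and diff: "\<And>u v. u \<in> I \<Longrightarrow> v \<in> I \<Longrightarrow> u - v \<in> I"
    using assms by (auto simp: additive_subgroup_set_def)
  have add: "u + v \<in> I" if "u \<in> I" "v \<in> I" for u v
    using diff[OF that(1) diff[OF zero that(2)]] by simp
  have JI: "additive_subgroup_set J"
    unfolding additive_subgroup_set_def
  proof (intro conjI ballI)
    show "0 \<in> J" using zero by (auto simp: J_def intro: exI[of _ 0])
    fix f g assume "f \<in> J" "g \<in> J"
    then obtain u v where "f - m * u \<in> I" "g - m * v \<in> I" by (auto simp: J_def)
    from diff[OF this] have "f - g - m * (u - v) \<in> I" by (simp add: algebra_simps)
    then show "f - g \<in> J" by (auto simp: J_def)
  qed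
  have KI: "additive_subgroup_set K"
    using zero diff by (auto simp: additive_subgroup_set_def K_def right_diff_distrib)
  define rJ where "rJ A = (SOME f. coset J f = A)" for A
  define rK where "rK A = (SOME f. coset K f = A)" for A
  have rJ: "coset J (rJ A) = A" if "A \<in> range (coset J)" for A
    unfolding rJ_def by (rule someI_ex) (use that in auto)
  have rK: "coset K (rK A) = A" if "A \<in> range (coset K)" for A
    unfolding rK_def by (rule someI_ex) (use that in auto)
  have "bij_betw (\<lambda>(A, B). coset I (rJ A + m * rK B))
          (range (coset J) \<times> range (coset K)) (range (coset I))"
    unfolding bij_betw_def
  proof (intro conjI inj_onI)
    fix P Q assume P: "P \<in> range (coset J) \<times> range (coset K)"
      and Q: "Q \<in> range (coset J) \<times> range (coset K)"
      and eq: "(case P of (A, B) \<Rightarrow> coset I (rJ A + m * rK B)) =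
               (case Q of (A, B) \<Rightarrow> coset I (rJ A + m * rK B))"
    obtain A B A' B' where PQ: "P = (A, B)" "Q = (A', B')" by (metis surj_pair)
    have d: "rJ A + m * rK B - (rJ A' + m * rK B') \<in> I"
      using eq by (simp add: PQ coset_eq_iff[OF assms])
    have "rJ A - rJ A' - m * (rK B' - rK B) \<in> I"
      using d by (simp add: algebra_simps)
    then have "rJ A - rJ A' \<in> J" by (auto simp: J_def)
    then have "coset J (rJ A) = coset J (rJ A')" by (simp add: coset_eq_iff[OF JI])
    with P Q have AA: "A = A'" using rJ by (simp add: PQ)
    with d have "rK B - rK B' \<in> K" by (simp add: K_def algebra_simps)
    then have "coset K (rK B) = coset K (rK B')" by (simp add: coset_eq_iff[OF KI])
    with P Q have "B = B'" using rK by (simp add: PQ)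
    with AA show "P = Q" by (simp add: PQ)
  next
    show "(\<lambda>(A, B). coset I (rJ A + m * rK B)) ` (range (coset J) \<times> range (coset K))
            = range (coset I)"
    proof (intro equalityI subsetI)
      fix C assume "C \<in> range (coset I)"
      then obtain f where C: "C = coset I f" by auto
      define a where "a = rJ (coset J f)"
      have "coset J f = coset J a" using rJ[of "coset J f"] by (simp add: a_def)
      then have "f - a \<in> J" by (simp add: coset_eq_iff[OF JI])
      then obtain g where g: "f - a - m * g \<in> I" by (auto simp: J_def)
      define b where "b = rK (coset K g)"
      have "coset K g = coset K b" using rK[of "coset K g"] by (simp add: b_def)
      then have "g - b \<in> K" by (simp add: coset_eq_iff[OF KI])
      then have "m * (g - b) \<in> I" by (simp add: K_def)
      from add[OF g this] have "f - (a + m * b) \<in> I" by (simp add: algebra_simps)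
      then have "C = coset I (a + m * b)" by (simp add: C coset_eq_iff[OF assms])
      then show "C \<in> (\<lambda>(A, B). coset I (rJ A + m * rK B)) ` (range (coset J) \<times> range (coset K))"
        by (intro image_eqI[of _ _ "(coset J f, coset K g)"]) (auto simp: a_def b_def)
    qed auto
  qed
  then have "card (range (coset J) \<times> range (coset K)) = card (range (coset I))"
    by (rule bij_betw_same_card)
  then show ?thesis by (simp add: coset_index_def card_cartesian_product J_def K_def)
qed

text \<open>The map \<open>\<phi>\<close> induces a bijection between the cosets of the preimage and
  those of \<open>J\<close>. Its inverse is the map written down: choose a representative, then a
  preimage of it.\<close>

lemma coset_index_vimage:
  assumes "additive_subgroup_set J" and "additive \<phi>" and "surj \<phi>"
  shows "coset_index (\<phi> -` J) = coset_index J"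
proof -
  interpret additive \<phi> by fact
  have I: "additive_subgroup_set (\<phi> -` J)"
    using assms(1) by (auto simp: additive_subgroup_set_def zero diff)
  have eq: "coset (\<phi> -` J) f = coset (\<phi> -` J) g \<longleftrightarrow> coset J (\<phi> f) = coset J (\<phi> g)" for f g
    by (simp add: coset_eq_iff[OF I] coset_eq_iff[OF assms(1)] diff)
  have "bij_betw (\<lambda>A. coset (\<phi> -` J) (inv_into UNIV \<phi> (SOME f. coset J f = A)))
      (range (coset J)) (range (coset (\<phi> -` J)))"
  proof (rule bij_betwI')
    have r: "coset J (SOME f. coset J f = A) = A" if "A \<in> range (coset J)" for A
      by (rule someI_ex) (use that in auto)
    show "(coset (\<phi> -` J) (inv_into UNIV \<phi> (SOME f. coset J f = A)) =
           coset (\<phi> -` J) (inv_into UNIV \<phi> (SOME f. coset J f = B))) = (A = B)"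
      if "A \<in> range (coset J)" "B \<in> range (coset J)" for A B
      using r[OF that(1)] r[OF that(2)] by (simp add: eq surj_f_inv_f[OF assms(3)])
    show "\<exists>A\<in>range (coset J). C = coset (\<phi> -` J) (inv_into UNIV \<phi> (SOME f. coset J f = A))"
      if "C \<in> range (coset (\<phi> -` J))" for C
    proof -
      from that obtain f where C: "C = coset (\<phi> -` J) f" by auto
      show ?thesis
        by (rule bexI[of _ "coset J (\<phi> f)"])
          (use r[of "coset J (\<phi> f)"] in \<open>auto simp: C eq surj_f_inv_f[OF assms(3)]\<close>)
    qed
  qed auto
  then show ?thesis unfolding coset_index_def by (rule bij_betw_same_card[symmetric])
qed

section \<open>Ideals with two or three generators, coprimality and the colon ideal\<close>

definition gen2 :: "'a::comm_ring_1 \<Rightarrow> 'a \<Rightarrow> 'a set" where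
  "gen2 p q = {u * p + v * q | u v. True}"

definition gen3 :: "'a::comm_ring_1 \<Rightarrow> 'a \<Rightarrow> 'a \<Rightarrow> 'a set" where
  "gen3 p q r = {u * p + v * q + w * r | u v w. True}"

lemma additive_subgroup_set_gen2: "additive_subgroup_set (gen2 p q)"
  unfolding additive_subgroup_set_def gen2_def
proof (safe, goal_cases)
  case 1
  show ?case by (rule exI[of _ 0], rule exI[of _ 0]) simp
next
  case (2 _ _ u u' v v')
  show ?case by (rule exI[of _ "u - u'"], rule exI[of _ "v - v'"]) (simp add: algebra_simps)
qed

lemma additive_subgroup_set_gen3: "additive_subgroup_set (gen3 p q r)"
  unfolding additive_subgroup_set_def gen3_def
proof (safe, goal_cases)
  case 1
  show ?case by (rule exI[of _ 0], rule exI[of _ 0], rule exI[of _ 0]) simp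
next
  case (2 _ _ u u' v v' w w')
  show ?case
    by (rule exI[of _ "u - u'"], rule exI[of _ "v - v'"], rule exI[of _ "w - w'"])
      (simp add: algebra_simps)
qed

lemma gen2_commute: "gen2 p q = gen2 q p"
  unfolding gen2_def by (metis add.commute)

text \<open>Identifies the sum factor in \<open>coset_index_sum_colon\<close> when a third generator
  is adjoined.\<close>

lemma sum_gen2: "{f. \<exists>g. f - r * g \<in> gen2 p q} = gen3 p q r"
proof -
  have "f - r * g = u * p + v * q \<longleftrightarrow> f = u * p + v * q + g * r" for f g u v
    by (auto simp: algebra_simps)
  then show ?thesis by (auto simp: gen2_def gen3_def)
qed

text \<open>This says that \<open>q\<close> is not a zero divisor modulo \<open>p\<close>. It is
  weaker than comaximality: it holds for two distinct variables.\<close>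

definition rel_prime :: "'a::comm_ring_1 \<Rightarrow> 'a \<Rightarrow> bool" where
  "rel_prime p q \<longleftrightarrow> (\<forall>f. p dvd q * f \<longrightarrow> p dvd f)"

lemma rel_primeD:
  assumes "rel_prime p q" and "q * f = p * g"
  obtains h where "f = p * h"
  using assms unfolding rel_prime_def by (metis dvd_def)

lemma rel_prime_mult_right: "rel_prime p q \<Longrightarrow> rel_prime p r \<Longrightarrow> rel_prime p (q * r)"
  unfolding rel_prime_def by (metis mult.assoc)

lemma rel_prime_power_right: "rel_prime p q \<Longrightarrow> rel_prime p (q ^ n)"
proof (induction n)
  case 0
  show ?case by (simp add: rel_prime_def)
next
  case (Suc n)
  then show ?case by (metis rel_prime_mult_right power_Suc)
qed

lemma rel_prime_sym:
  fixes p q :: "'a::idom"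
  assumes "rel_prime p q" and "p \<noteq> 0"
  shows "rel_prime q p"
  unfolding rel_prime_def
proof (intro allI impI)
  fix f assume "q dvd p * f"
  then obtain g where g: "p * f = q * g" by (rule dvdE)
  then obtain h where "g = p * h" using rel_primeD[OF assms(1), of g f] by metis
  with g have "p * f = p * (q * h)" by (simp add: algebra_simps)
  with assms(2) show "q dvd f" by simp
qed

text \<open>Powers can be taken on the right only, so the arguments are exchanged between the two
  exponents.\<close>

lemma rel_prime_power_power:
  fixes p q :: "'a::idom"
  assumes "prime_elem p" and "\<not> p dvd q" and "q \<noteq> 0"
  shows "rel_prime (p ^ m) (q ^ n)"
proof -
  have "p \<noteq> 0" using assms(1) by auto
  have "rel_prime p q"
    unfolding rel_prime_def using prime_elem_dvd_mult_iff[OF assms(1)] assms(2) by blast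
  from rel_prime_sym[OF rel_prime_power_right[OF this] \<open>p \<noteq> 0\<close>]
  have "rel_prime (q ^ n) (p ^ m)" by (rule rel_prime_power_right)
  then show ?thesis by (rule rel_prime_sym) (use assms(3) in simp)
qed

text \<open>For the ideal (p, qr) and the multiplier \<open>q\<close>, the sum is (p, q) and the
  colon ideal is (p, r). Coprimality serves to cancel \<open>q\<close> in the colon ideal.\<close>

lemma coset_index_gen2_mult:
  assumes "rel_prime p q"
  shows "coset_index (gen2 p (q * r)) = coset_index (gen2 p q) * coset_index (gen2 p r)"
proof -
  have 1: "{f. \<exists>g. f - q * g \<in> gen2 p (q * r)} = gen2 p q"
  proof (intro equalityI subsetI; clarsimp simp: gen2_def)
    fix f g u v assume "f - q * g = u * p + v * (q * r)"
    then have "f = u * p + (g + v * r) * q" by (simp add: algebra_simps)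
    then show "\<exists>u v. f = u * p + v * q" by blast
  next
    fix u v
    have "u * p + v * q - q * v = u * p + 0 * (q * r)" by (simp add: algebra_simps)
    then show "\<exists>g u' v'. u * p + v * q - q * g = u' * p + v' * (q * r)" by blast
  qed
  have 2: "{f. q * f \<in> gen2 p (q * r)} = gen2 p r"
  proof (intro equalityI subsetI; clarsimp simp: gen2_def)
    fix f u v assume "q * f = u * p + v * (q * r)"
    then have "q * (f - v * r) = p * u" by (simp add: algebra_simps)
    with assms obtain w where "f - v * r = p * w" by (rule rel_primeD)
    then have "f = w * p + v * r" by (simp add: algebra_simps)
    then show "\<exists>u v. f = u * p + v * r" by blast
  next
    fix u v
    have "q * (u * p + v * r) = (q * u) * p + v * (q * r)" by (simp add: algebra_simps)
    then show "\<exists>u' v'. q * (u * p + v * r) = u' * p + v' * (q * r)" by blast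
  qed
  show ?thesis
    using coset_index_sum_colon[OF additive_subgroup_set_gen2, of p "q * r" q] by (simp add: 1 2)
qed

lemma coset_index_gen2_one: "coset_index (gen2 p 1) = 1"
proof -
  have "gen2 p 1 = UNIV" unfolding gen2_def
    by (auto intro: exI[of _ 0])
  moreover have "coset UNIV f = UNIV" for f :: 'a
    by (auto simp: coset_def image_iff intro: exI[of _ "_ - f"])
  ultimately show ?thesis by (simp add: coset_index_def)
qed

lemma coset_index_gen2_power:
  assumes "rel_prime p q"
  shows "coset_index (gen2 p (q ^ n)) = coset_index (gen2 p q) ^ n"
  by (induction n) (simp_all add: coset_index_gen2_one coset_index_gen2_mult[OF assms])

lemma coset_index_gen2_power_power:
  fixes p q :: "'a::idom"
  assumes "prime_elem p" and "\<not> p dvd q" and "q \<noteq> 0"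
  shows "coset_index (gen2 (p ^ m) (q ^ n)) = coset_index (gen2 p q) ^ (m * n)"
proof -
  have rel_prime: "rel_prime (p ^ m) q" "rel_prime q p"
    using rel_prime_power_power[OF assms, of m 1] rel_prime_power_power[OF assms, of 1 1]
      rel_prime_sym[of p q] assms(1) by simp_all
  have "coset_index (gen2 (p ^ m) (q ^ n)) = coset_index (gen2 q (p ^ m)) ^ n"
    unfolding coset_index_gen2_power[OF rel_prime(1)] by (simp only: gen2_commute)
  also have "\<dots> = coset_index (gen2 p q) ^ (m * n)"
    unfolding coset_index_gen2_power[OF rel_prime(2)] by (simp only: gen2_commute[of q] power_mult)
  finally show ?thesis .
qed

text \<open>
  Applied with \<open>p = x\<^bsup>a\<^esup>\<close>, \<open>P = x\<^bsup>s\<^esup>\<close>, \<open>q = y\<^bsup>b\<^esup>\<close>, \<open>Q = y\<^bsup>s\<^esup>\<close>, \<open>r = t\<^bsup>c\<^esup>\<close>, \<open>T = t\<^bsup>s\<^esup>\<close>; the exponents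
  disappear, and only the relation \<open>T = P + Q\<close> and coprimality matter.
\<close>

lemma colon_gen2:
  fixes p q r :: "'a::idom"
  assumes two: "(2::'a) = 0"
    and P: "P = p * p'" and Q: "Q = q * q'" and T: "T = r * r'" "T = P + Q"
    and rel_prime: "rel_prime T P" "rel_prime p q" "rel_prime r' (p * q)"
    and nz: "T \<noteq> 0" "r' \<noteq> 0"
  shows "{f. (r' * T) * f \<in> gen2 (p * P) (q * Q)} = gen2 r (p * q)"
proof (intro equalityI subsetI)
  \<comment> \<open>Signs are free in characteristic two. Having both forms of \<open>T\<close>
    gives \<open>T * T = P * P - Q * Q\<close>.\<close>
  have T': "T = P - Q"
  proof -
    have "Q + Q = 0" using two by (metis mult_2 mult_zero_left)
    then show ?thesis using T(2) by (simp add: eq_neg_iff_add_eq_0)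
  qed
  fix f
  show "f \<in> gen2 r (p * q)" if "f \<in> {f. (r' * T) * f \<in> gen2 (p * P) (q * Q)}"
  proof -
    from that obtain A B where AB: "r' * T * f = A * (p * P) + B * (q * Q)"
      by (auto simp: gen2_def)
    \<comment> \<open>Substituting Q = T - P in \<open>AB\<close> collects all multiples of
      \<open>T\<close> on one side.\<close>
    have e1: "P * (A * p - B * q) = T * (r' * f - B * q)"
      using AB by (simp add: T(2) algebra_simps)
    with rel_prime(1) obtain G where G: "A * p - B * q = T * G" by (rule rel_primeD)
    with e1 have "T * (r' * f - B * q) = T * (P * G)" by (simp add: algebra_simps)
    with nz(1) have e2: "r' * f - B * q = P * G" by simp
    \<comment> \<open>Expand \<open>T * G\<close> as \<open>(p * p' + q * q') * G\<close> and
      separate the multiples of \<open>p\<close> from those of \<open>q\<close>.\<close>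
    have e3: "q * (B + q' * G) = p * (A - p' * G)"
      using G by (simp add: T(2) P Q algebra_simps)
    with rel_prime(2) obtain H where H: "B + q' * G = p * H" by (rule rel_primeD)
    have "B * q = q * (B + q' * G) - Q * G" by (simp add: Q algebra_simps)
    then have Bq: "B * q = p * q * H - Q * G" unfolding H by (simp add: mult_ac)
    \<comment> \<open>Eliminating \<open>B\<close> leaves \<open>(P - Q) * G\<close>, which is
      \<open>T * G\<close> and hence \<open>r * r' * G\<close>.\<close>
    have e4: "(p * q) * H = r' * (f - r * G)"
      using e2 Bq T(1) T' by (simp add: algebra_simps)
    with rel_prime(3) obtain H' where "H = r' * H'" by (rule rel_primeD)
    with e4 have "r' * (f - r * G) = r' * (p * q * H')" by (simp add: algebra_simps)
    with nz(2) have "f - r * G = p * q * H'" by simp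
    then have "f = G * r + H' * (p * q)" by (simp add: algebra_simps)
    then show ?thesis by (auto simp: gen2_def)
  qed
  show "f \<in> {f. (r' * T) * f \<in> gen2 (p * P) (q * Q)}" if "f \<in> gen2 r (p * q)"
  proof -
    from that obtain u v where f: "f = u * r + v * (p * q)" by (auto simp: gen2_def)
    \<comment> \<open>The generator \<open>r\<close> completes \<open>r'\<close> to a second factor
      \<open>T\<close>, and \<open>P * P\<close>, \<open>Q * Q\<close> are multiples of
      \<open>p * P\<close>, \<open>q * Q\<close>.\<close>
    have "(r' * T) * (u * r) = u * T * T" using T(1) by (simp add: algebra_simps)
    also have "\<dots> = u * (P + Q) * (P - Q)" using T(2) T' by metis
    also have "\<dots> = (u * p') * (p * P) + (- u * q') * (q * Q)"
      by (simp add: P Q algebra_simps)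
    finally have "(r' * T) * f = (u * p') * (p * P) + (- u * q') * (q * Q) + r' * (P + Q) * v * (p * q)"
      by (simp add: f T(2) algebra_simps)
    also have "\<dots> = (u * p' + r' * v * q) * (p * P) + (- u * q' + r' * v * p) * (q * Q)"
      by (simp add: algebra_simps)
    finally show ?thesis by (auto simp: gen2_def)
  qed
qed

section \<open>The ring F_2[x, y] and the index of the three-generator ideal\<close>

text \<open>Divisibility by X - c means vanishing at \<open>c\<close>, and evaluation is
  multiplicative into a domain.\<close>

lemma prime_elem_monic_linear: "prime_elem [:- c, 1::'a::idom:]"
  by (rule prime_elemI) (auto simp: poly_eq_0_iff_dvd[symmetric] is_unit_poly_iff)

definition vx :: "bit poly poly" where "vx = [:[:0, 1:]:]"
definition vy :: "bit poly poly" where "vy = [:0, 1:]"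

lemma UNIV_bit: "(UNIV :: bit set) = {0, 1}"
  by auto

lemma two_eq_0: "(2 :: bit poly poly) = 0"
proof -
  have "(2 :: bit poly poly) = [:[:2:]:]" by (simp add: numeral_poly)
  then show ?thesis by simp
qed

text \<open>The sign is vacuous over F_2; it exhibits x + y as the monic linear polynomial in y with
  root x.\<close>

lemma vx_plus_vy: "vx + vy = [:- [:0, 1:], 1:]"
  by (simp add: vx_def vy_def)

lemma prime_elem_vx: "prime_elem vx"
  using prime_elem_monic_linear[of "0::bit"] by (simp add: vx_def lift_prime_elem_poly)

lemma prime_elem_vx_plus_vy: "prime_elem (vx + vy)"
  unfolding vx_plus_vy by (rule prime_elem_monic_linear)

lemma not_vx_dvd_vy: "\<not> vx dvd vy"
proof
  assume "vx dvd vy"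
  then have "[:0, 1::bit:] dvd coeff vy 1" by (simp only: vx_def const_poly_dvd_iff)
  then show False by (auto simp: vy_def is_unit_poly_iff)
qed

text \<open>At y = x both variables take the nonzero value x.\<close>

lemma not_vx_plus_vy_dvd: "\<not> vx + vy dvd vx" "\<not> vx + vy dvd vy"
  unfolding vx_plus_vy poly_eq_0_iff_dvd[symmetric] by (simp_all add: vx_def vy_def)

lemma vx_vy_nonzero: "vx \<noteq> 0" "vy \<noteq> 0"
  by (simp_all add: vx_def vy_def)

text \<open>The ideal (x, y) is the kernel of evaluation at the origin, so its index is that of zero
  in F_2.\<close>

lemma gen2_vx_vy: "gen2 vx vy = (\<lambda>f. coeff (coeff f 0) 0) -` {0}"
proof (intro equalityI subsetI)
  fix f assume "f \<in> gen2 vx vy"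
  then show "f \<in> (\<lambda>f. coeff (coeff f 0) 0) -` {0}"
    by (auto simp: gen2_def vx_def vy_def)
next
  fix f :: "bit poly poly" assume f: "f \<in> (\<lambda>f. coeff (coeff f 0) 0) -` {0}"
  obtain g c where fg: "f = pCons c g" by (cases f)
  obtain h a where c: "c = pCons a h" by (cases c)
  have "f = [:h:] * vx + g * vy" using f by (simp add: fg c vx_def vy_def)
  then show "f \<in> gen2 vx vy" unfolding gen2_def by blast
qed

lemma coset_index_vx_vy: "coset_index (gen2 vx vy) = 2"
proof -
  have "coset_index (gen2 vx vy) = coset_index {0::bit}"
    unfolding gen2_vx_vy
  proof (rule coset_index_vimage)
    show "surj (\<lambda>f :: bit poly poly. coeff (coeff f 0) 0)"
      by (rule surjI[of _ "\<lambda>c. [:[:c:]:]"]) simp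
  qed (simp_all add: additive_def additive_subgroup_set_def)
  also have "range (coset {0::bit}) = {{0}, {1}}"
    by (auto simp: coset_def UNIV_bit)
  then have "coset_index {0::bit} = 2" by (simp add: coset_index_def)
  finally show ?thesis .
qed

lemma gen2_add_left: "gen2 (p + q) q = gen2 p q"
proof -
  have 1: "u * (p + q) + v * q = u * p + (u + v) * q" for u v by (simp add: algebra_simps)
  have 2: "u * p + v * q = u * (p + q) + (v - u) * q" for u v by (simp add: algebra_simps)
  show ?thesis unfolding gen2_def using 1 2 by (auto, metis+)
qed

lemma coset_index_vx_plus_vy:
  "coset_index (gen2 (vx + vy) vx) = 2" "coset_index (gen2 (vx + vy) vy) = 2"
  using coset_index_vx_vy gen2_add_left[of vy vx] gen2_add_left[of vx vy]
  by (simp_all add: add.commute gen2_commute[of vy])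

lemma power_two_power_add:
  fixes x y :: "'a::comm_ring_1"
  assumes "(2::'a) = 0"
  shows "(x + y) ^ (2 ^ j) = x ^ (2 ^ j) + y ^ (2 ^ j)"
proof (induction j)
  case (Suc j)
  have "(x + y) ^ 2 ^ Suc j = ((x + y) ^ 2 ^ j)\<^sup>2" by (simp add: power_mult[symmetric] mult.commute)
  also have "\<dots> = (x ^ 2 ^ j)\<^sup>2 + (y ^ 2 ^ j)\<^sup>2"
    unfolding Suc.IH power2_sum using assms by simp
  finally show ?case by (simp add: power_mult[symmetric] mult.commute)
qed simp

text \<open>The right-hand side is the index of (x^(s+a), y^(s+b)), and
  \<open>2 ^ (k * (a + b))\<close> is the index of its colon ideal by t^(2s-k). The product form
  avoids subtraction in the exponent.\<close>

lemma coset_index_gen3_vx_vy: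
  assumes s: "s = 2 ^ j" and le: "a \<le> s" "b \<le> s" "k \<le> s"
  shows "coset_index (gen3 (vx ^ (s + a)) (vy ^ (s + b)) ((vx + vy) ^ (2 * s - k))) * 2 ^ (k * (a + b))
       = 2 ^ ((s + a) * (s + b))"
proof -
  let ?t = "vx + vy"
  have nz: "vx \<noteq> 0" "vy \<noteq> 0" "?t \<noteq> 0"
    using vx_vy_nonzero prime_elem_vx_plus_vy by auto
  have rel_prime: "rel_prime (?t ^ m) (vx ^ n)" "rel_prime (?t ^ m) (vy ^ n)"
    "rel_prime (vx ^ m) (vy ^ n)" for m n
    by (rule rel_prime_power_power; fact prime_elem_vx_plus_vy prime_elem_vx not_vx_plus_vy_dvd
        not_vx_dvd_vy nz)+
  \<comment> \<open>Here \<open>r'\<close> is \<open>?t ^ (s - k)\<close>, so \<open>r' * T\<close>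
    is the third generator. That \<open>s\<close> is a power of two yields
    \<open>?t ^ s = vx ^ s + vy ^ s\<close>.\<close>
  have "{f. (?t ^ (s - k) * ?t ^ s) * f \<in> gen2 (vx ^ a * vx ^ s) (vy ^ b * vy ^ s)}
      = gen2 (?t ^ k) (vx ^ a * vy ^ b)"
  proof (rule colon_gen2[OF two_eq_0])
    show "vx ^ s = vx ^ a * vx ^ (s - a)" "vy ^ s = vy ^ b * vy ^ (s - b)"
      "?t ^ s = ?t ^ k * ?t ^ (s - k)"
      using le by (simp_all add: power_add[symmetric])
    show "?t ^ s = vx ^ s + vy ^ s" unfolding s by (rule power_two_power_add[OF two_eq_0])
  qed (use rel_prime nz in \<open>auto intro: rel_prime_mult_right\<close>)
  moreover have "?t ^ (s - k) * ?t ^ s = ?t ^ (2 * s - k)"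
    using le by (simp add: power_add[symmetric] mult_2)
  ultimately have colon:
    "{f. ?t ^ (2 * s - k) * f \<in> gen2 (vx ^ (s + a)) (vy ^ (s + b))} = gen2 (?t ^ k) (vx ^ a * vy ^ b)"
    by (simp add: power_add mult.commute)
  have "2 ^ ((s + a) * (s + b)) = coset_index (gen2 (vx ^ (s + a)) (vy ^ (s + b)))"
    by (simp add: coset_index_gen2_power_power[OF prime_elem_vx not_vx_dvd_vy nz(2)] coset_index_vx_vy)
  also have "\<dots> = coset_index (gen3 (vx ^ (s + a)) (vy ^ (s + b)) (?t ^ (2 * s - k)))
      * coset_index (gen2 (?t ^ k) (vx ^ a * vy ^ b))"
    by (subst coset_index_sum_colon[OF additive_subgroup_set_gen2, where m = "?t ^ (2 * s - k)"])
      (simp only: sum_gen2 colon)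
  also have "coset_index (gen2 (?t ^ k) (vx ^ a * vy ^ b)) = 2 ^ (k * a) * 2 ^ (k * b)"
    by (simp add: coset_index_gen2_mult[OF rel_prime(1)] nz coset_index_vx_plus_vy
        coset_index_gen2_power_power[OF prime_elem_vx_plus_vy] not_vx_plus_vy_dvd)
  finally show ?thesis by (simp add: power_add distrib_left)
qed

section \<open>Ideals of F_2[x, y, z] and elimination of z\<close>

lemma cring_F2_xyz: "cring F2_xyz_ring"
  unfolding F2_xyz_ring_def by (rule cring_from_type_algebra)

lemma F2_xyz_ring_simps [simp]:
  "carrier F2_xyz_ring = UNIV" "f \<oplus>\<^bsub>F2_xyz_ring\<^esub> g = f + g" "f \<otimes>\<^bsub>F2_xyz_ring\<^esub> g = f * g"
  "\<zero>\<^bsub>F2_xyz_ring\<^esub> = 0" "\<one>\<^bsub>F2_xyz_ring\<^esub> = 1"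
  by (simp_all add: F2_xyz_ring_def ring_of_type_algebra_def)

lemma a_minus_F2_xyz: "\<ominus>\<^bsub>F2_xyz_ring\<^esub> f = - f"
proof -
  interpret cring F2_xyz_ring by (rule cring_F2_xyz)
  show ?thesis by (rule minus_equality) auto
qed

lemma ideal_F2_xyzI:
  assumes "additive_subgroup_set I" and "\<And>f g. f \<in> I \<Longrightarrow> g * f \<in> I"
  shows "ideal I F2_xyz_ring"
proof -
  interpret cring F2_xyz_ring by (rule cring_F2_xyz)
  have zero: "0 \<in> I" and diff: "\<And>u v. u \<in> I \<Longrightarrow> v \<in> I \<Longrightarrow> u - v \<in> I"
    using assms(1) by (auto simp: additive_subgroup_set_def)
  have minus: "- u \<in> I" if "u \<in> I" for u
    using diff[OF zero that] by simp
  have add: "u + v \<in> I" if "u \<in> I" "v \<in> I" for u v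
    using diff[OF that(1) minus[OF that(2)]] by simp
  show ?thesis
  proof (rule idealI)
    show "subgroup I (add_monoid F2_xyz_ring)"
      by (rule add.subgroupI)
        (use zero minus add in \<open>auto simp: a_inv_def[symmetric] a_minus_F2_xyz\<close>)
  qed (use assms(2) in \<open>auto simp: ring_axioms mult.commute\<close>)
qed

lemma ideal_F2_xyzD:
  assumes "ideal I F2_xyz_ring"
  shows "f \<in> I \<Longrightarrow> g \<in> I \<Longrightarrow> f + g \<in> I" "f \<in> I \<Longrightarrow> g * f \<in> I" "additive_subgroup_set I"
proof -
  interpret ideal I F2_xyz_ring by fact
  show add: "f + g \<in> I" if "f \<in> I" "g \<in> I" for f g
    using additive_subgroup.a_closed[OF is_additive_subgroup that] by simp
  show mult: "g * f \<in> I" if "f \<in> I" for f g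
    using I_l_closed[OF that, of g] by simp
  show "additive_subgroup_set I"
    unfolding additive_subgroup_set_def
  proof (intro conjI ballI)
    show "0 \<in> I" using additive_subgroup.zero_closed[OF is_additive_subgroup] by simp
    fix f g assume "f \<in> I" "g \<in> I"
    moreover from \<open>g \<in> I\<close> have "- g \<in> I" using mult[of g "- 1"] by simp
    ultimately show "f - g \<in> I" using add[of f "- g"] by simp
  qed
qed

lemma gen3_mult: "f \<in> gen3 p q r \<Longrightarrow> g * f \<in> gen3 p q r"
proof -
  assume "f \<in> gen3 p q r"
  then obtain u v w where "f = u * p + v * q + w * r" by (auto simp: gen3_def)
  then have "g * f = (g * u) * p + (g * v) * q + (g * w) * r" by (simp add: algebra_simps)
  then show ?thesis unfolding gen3_def by blast
qed

text \<open>Evaluation at z = x + y is the quotient map by (x + y + z), because -(x + y) = x + y. It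
  sends the other generators to those of the \<open>gen3\<close> ideal, so the ideal is the full
  preimage.\<close>

lemma xyz_ideal_eq_vimage:
  "xyz_ideal d1 d2 d3 =
     (\<lambda>f. poly f (vx + vy)) -` gen3 (vx ^ d1) (vy ^ d2) ((vx + vy) ^ d3)"
  (is "_ = ?\<phi> -` ?G")
proof (intro equalityI)
  interpret cring F2_xyz_ring by (rule cring_F2_xyz)
  let ?S = "{var_x ^ d1, var_y ^ d2, var_z ^ d3, var_x + var_y + var_z}"
  have \<phi>: "?\<phi> var_x = vx" "?\<phi> var_y = vy" "?\<phi> var_z = vx + vy"
    by (simp_all add: var_x_def var_y_def var_z_def vx_def vy_def)
  have twice: "vx + vy + (vx + vy) = 0"
    using two_eq_0 by (metis mult_2 mult_zero_left)
  show "xyz_ideal d1 d2 d3 \<subseteq> ?\<phi> -` ?G"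
    unfolding xyz_ideal_def
  proof (rule genideal_minimal)
    show "ideal (?\<phi> -` ?G) F2_xyz_ring"
      using additive_subgroup_set_gen3[of "vx ^ d1" "vy ^ d2" "(vx + vy) ^ d3"]
      by (intro ideal_F2_xyzI) (auto simp: additive_subgroup_set_def gen3_mult)
    have "vx ^ d1 \<in> ?G" "vy ^ d2 \<in> ?G" "(vx + vy) ^ d3 \<in> ?G" "0 \<in> ?G"
      unfolding gen3_def mem_Collect_eq
      by (rule exI[of _ 1], rule exI[of _ 0], rule exI[of _ 0], simp)
        (rule exI[of _ 0], rule exI[of _ 1], rule exI[of _ 0], simp,
         rule exI[of _ 0], rule exI[of _ 0], rule exI[of _ 1], simp,
         rule exI[of _ 0], rule exI[of _ 0], rule exI[of _ 0], simp)
    then show "?S \<subseteq> ?\<phi> -` ?G"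
      by (simp add: \<phi> twice poly_power poly_add)
  qed
  let ?I = "xyz_ideal d1 d2 d3"
  have I: "ideal ?I F2_xyz_ring"
    unfolding xyz_ideal_def by (rule genideal_ideal) simp
  have S: "?S \<subseteq> ?I"
    unfolding xyz_ideal_def by (rule genideal_self) simp
  note add = ideal_F2_xyzD(1)[OF I] and mult = ideal_F2_xyzD(2)[OF I]
  have lin: "[:vx + vy, 1:] \<in> ?I"
    using S by (simp add: var_x_def var_y_def var_z_def vx_def vy_def)
  have neg: "- (vx + vy) = vx + vy"
    by (rule Groups.minus_unique[OF twice])
  \<comment> \<open>Modulo the ideal, every \<open>f\<close> agrees with its value at z = x + y, by
    the factor theorem for the root x + y.\<close>
  have diff_const: "f - [:poly f (vx + vy):] \<in> ?I" for f
  proof -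
    have "poly (f - [:poly f (vx + vy):]) (vx + vy) = 0" by simp
    then have "[:vx + vy, 1:] dvd f - [:poly f (vx + vy):]"
      by (simp only: poly_eq_0_iff_dvd neg)
    then obtain g where "f - [:poly f (vx + vy):] = [:vx + vy, 1:] * g" by (rule dvdE)
    then show ?thesis using mult[OF lin, of g] by (simp only: mult.commute)
  qed
  show "?\<phi> -` ?G \<subseteq> ?I"
  proof
    fix f assume "f \<in> ?\<phi> -` ?G"
    then obtain u v w where f: "poly f (vx + vy) = u * vx ^ d1 + v * vy ^ d2 + w * (vx + vy) ^ d3"
      by (auto simp: gen3_def)
    have var: "var_x = [:vx:]" "var_y = [:vy:]"
      by (simp_all add: var_x_def var_y_def vx_def vy_def)
    have p: "var_x ^ d1 = [:vx ^ d1:]" "var_y ^ d2 = [:vy ^ d2:]"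
      unfolding var poly_const_pow by (rule refl)+
    have "[:vx ^ d1:] \<in> ?I" "[:vy ^ d2:] \<in> ?I" "var_z ^ d3 \<in> ?I"
      unfolding p[symmetric] using S by auto
    \<comment> \<open>The third generator is a power of z, so it is first replaced by its value, a
      constant in z.\<close>
    moreover have "[:(vx + vy) ^ d3:] \<in> ?I"
    proof -
      have "poly (var_z ^ d3) (vx + vy) = (vx + vy) ^ d3" by (simp add: \<phi> poly_power)
      then have "var_z ^ d3 - [:(vx + vy) ^ d3:] \<in> ?I" using diff_const[of "var_z ^ d3"] by simp
      then have "var_z ^ d3 - (var_z ^ d3 - [:(vx + vy) ^ d3:]) \<in> ?I"
        using \<open>var_z ^ d3 \<in> ?I\<close> ideal_F2_xyzD(3)[OF I] unfolding additive_subgroup_set_def by blast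
      then show ?thesis by simp
    qed
    ultimately have "[:u:] * [:vx ^ d1:] + [:v:] * [:vy ^ d2:] + [:w:] * [:(vx + vy) ^ d3:] \<in> ?I"
      by (intro add mult)
    then have "[:poly f (vx + vy):] \<in> ?I" by (simp add: f mult.commute)
    from add[OF diff_const[of f] this] show "f \<in> ?I" by simp
  qed
qed

lemma coset_index_xyz_ideal:
  "coset_index (xyz_ideal d1 d2 d3) = coset_index (gen3 (vx ^ d1) (vy ^ d2) ((vx + vy) ^ d3))"
  unfolding xyz_ideal_eq_vimage
proof (rule coset_index_vimage)
  show "surj (\<lambda>f. poly f (vx + vy))" by (rule surjI[of _ "\<lambda>c. [:c:]"]) simp
qed (simp_all add: additive_def additive_subgroup_set_gen3)

section \<open>Dimension from cardinality\<close>

text \<open>Each step of \<open>dimension\<close> adjoins some \<open>v\<close> outside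
  \<open>E\<close>, so the line extension is the direct sum of Kv and \<open>E\<close> and its
  cardinality is a product.\<close>

lemma (in ring) card_dimension:
  assumes K: "subfield K R" and "dimension n K E"
  shows "card E = card K ^ n"
  using assms(2,1)
proof (induction rule: dimension.induct)
  case (Suc_dim v E n K)
  note K = Suc_dim.prems
  note E = space_subgroup_props[OF K Suc_dim.hyps(3)]
  note sub = subringE[OF subfieldE(1)[OF K]]
  have eq: "line_extension K v E = (\<lambda>(k, e). k \<otimes> v \<oplus> e) ` (K \<times> E)"
    by (force simp: line_extension_mem_iff)
  have "inj_on (\<lambda>(k, e). k \<otimes> v \<oplus> e) (K \<times> E)"
  proof (rule inj_onI, clarsimp)
    fix k e k' e'
    assume in_KE: "k \<in> K" "e \<in> E" "k' \<in> K" "e' \<in> E" and eq: "k \<otimes> v \<oplus> e = k' \<otimes> v \<oplus> e'"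
    have car: "k \<in> carrier R" "k' \<in> carrier R" "e \<in> carrier R" "e' \<in> carrier R"
      using in_KE sub(1) E(1) by auto
    have v: "v \<in> carrier R" by fact
    have "(k \<oplus> \<ominus> k') \<otimes> v = (k \<otimes> v \<oplus> e) \<oplus> \<ominus> e \<oplus> \<ominus> (k' \<otimes> v)"
      using car v by algebra
    also have "\<dots> = (k' \<otimes> v \<oplus> e') \<oplus> \<ominus> e \<oplus> \<ominus> (k' \<otimes> v)" by (simp only: eq)
    also have "\<dots> = e' \<oplus> \<ominus> e" using car v by algebra
    finally have "(k \<oplus> \<ominus> k') \<otimes> v \<in> E" using E(3,4) in_KE by simp
    moreover have "k \<oplus> \<ominus> k' \<in> K" using sub(5,7) in_KE by simp
    \<comment> \<open>A nonzero scalar could be divided out, which would put \<open>v\<close> in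
      \<open>E\<close>.\<close>
    ultimately have "k \<oplus> \<ominus> k' = \<zero>" using E(6) v Suc_dim.hyps(2) by blast
    then have k: "k = k'" using car by (metis minus_equality minus_minus a_inv_closed add.m_comm)
    with eq car v show "k = k' \<and> e = e'" by simp
  qed
  then have "card (line_extension K v E) = card (K \<times> E)"
    unfolding eq by (rule card_image)
  then show ?case by (simp add: card_cartesian_product Suc_dim.IH[OF K])
qed simp

text \<open>The scalars form a two-element field, so the cardinality \<open>2 ^ n\<close> determines
  the dimension. Positivity of \<open>n\<close> makes the ideal proper, which keeps the classes of 0
  and 1 distinct.\<close>

lemma finite_dim_quot_dim_quot:
  assumes I: "ideal I F2_xyz_ring" and coset_index: "coset_index I = 2 ^ n" and "n > 0"
  shows "finite_dim_quot I \<and> dim_quot I = n"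
proof -
  let ?Q = "F2_xyz_ring Quot I"
  let ?h = "\<lambda>c. I +>\<^bsub>F2_xyz_ring\<^esub> const_F2 c"
  interpret I: ideal I F2_xyz_ring by fact
  interpret Q: ring ?Q by (rule I.quotient_is_ring)
  interpret B: field "ring_of_type_algebra :: bit ring" by (rule field_from_type_algebra)
  note sub = ideal_F2_xyzD(3)[OF I]
  have coset: "I +>\<^bsub>F2_xyz_ring\<^esub> f = coset I f" for f
    by (auto simp: a_r_coset_def' coset_def)
  have car: "carrier ?Q = range (coset I)"
    by (auto simp: FactRing_def A_RCOSETS_def' coset)
  then have card: "card (carrier ?Q) = 2 ^ n" using coset_index by (simp add: coset_index_def)
  have "(\<lambda>c. const_F2 c) \<in> ring_hom (ring_of_type_algebra :: bit ring) F2_xyz_ring"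
    by (rule ring_hom_memI)
      (simp_all add: ring_of_type_algebra_def const_F2_def one_pCons)
  from ring_hom_trans[OF this I.rcos_ring_hom]
  have "ring_hom_ring (ring_of_type_algebra :: bit ring) ?Q ?h"
    by (intro ring_hom_ringI2 B.ring_axioms Q.ring_axioms) (simp add: comp_def)
  then interpret h: ring_hom_ring "ring_of_type_algebra :: bit ring" ?Q ?h .
  have one: "\<one>\<^bsub>?Q\<^esub> \<noteq> \<zero>\<^bsub>?Q\<^esub>"
  proof
    assume "\<one>\<^bsub>?Q\<^esub> = \<zero>\<^bsub>?Q\<^esub>"
    then have "carrier ?Q = {\<zero>\<^bsub>?Q\<^esub>}" by (rule Q.one_zeroD)
    then have "card (carrier ?Q) = 1" by simp
    with card have "(2::nat) ^ n = 1" by metis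
    with \<open>n > 0\<close> show False by simp
  qed
  have scalars: "?h ` carrier (ring_of_type_algebra :: bit ring) = scalars_mod I"
    by (simp add: scalars_mod_def ring_of_type_algebra_def)
  have K: "subfield (scalars_mod I) ?Q"
    using h.img_is_subfield(2)[OF B.carrier_is_subfield one] by (simp add: scalars)
  have "inj ?h" using h.img_is_subfield(1)[OF B.carrier_is_subfield one]
    by (simp add: ring_of_type_algebra_def)
  then have cK: "card (scalars_mod I) = 2"
    by (simp add: scalars_mod_def card_image UNIV_bit)
  \<comment> \<open>An infinite carrier would have \<open>card\<close> equal to 0, which is not a
    power of two. A list of all elements then serves as a spanning family.\<close>
  have "finite (carrier ?Q)" using card by (metis card.infinite power_not_zero zero_neq_numeral)
  then obtain Us where Us: "set Us = carrier ?Q" using finite_list by blast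
  have "Q.Span (scalars_mod I) Us = carrier ?Q"
    using Q.Span_base_incl[OF K, of Us] Q.Span_subgroup_props(1)[OF K, of Us] Us by auto
  then have fin: "Q.finite_dimension (scalars_mod I) (carrier ?Q)"
    using Q.Span_finite_dimension[OF K, of Us] Us by simp
  have d: "Q.dimension (dim_quot I) (scalars_mod I) (carrier ?Q)"
    using Q.finite_dimensionE[OF K fin] by (simp add: over_def dim_quot_def)
  have "(2::nat) ^ n = 2 ^ dim_quot I"
    using Q.card_dimension[OF K d] by (simp only: card cK)
  then show ?thesis using fin by (simp add: finite_dim_quot_def)
qed

section \<open>The dimension formula\<close>

theorem theorem1p2:
  fixes q d1 d2 d3 :: nat
  assumes "\<exists>k::nat. q = 2 ^ k"
    and "real q / 2 < real d1" and "d1 \<le> q"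
    and "real q / 2 < real d2" and "d2 \<le> q"
    and "real q / 2 < real d3" and "d3 \<le> q"
  shows "finite_dim_quot (xyz_ideal d1 d2 d3) \<and>
    int (dim_quot (xyz_ideal d1 d2 d3)) =
      int d1 * int d2 + int d2 * int d3 + int d1 * int d3
        - int q * (int d1 + int d2 + int d3) + (int q)^2"
proof -
  have I: "ideal (xyz_ideal d1 d2 d3) F2_xyz_ring"
    unfolding xyz_ideal_def
    by (rule ring.genideal_ideal) (simp_all add: cring.axioms(1)[OF cring_F2_xyz])
  obtain k where q: "q = 2 ^ k" using assms(1) by auto
  show ?thesis
  proof (cases k)
    \<comment> \<open>For q = 1 there is no integral half \<open>s\<close>. All exponents are 1, x +
      y already lies in (x, y), and the quotient is F_2.\<close>
    case 0
    with q assms have d: "q = 1" "d1 = 1" "d2 = 1" "d3 = 1" by auto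
    have "gen3 vx vy (vx + vy) = gen2 vx vy"
      unfolding sum_gen2[symmetric]
    proof (intro equalityI subsetI; clarsimp)
      fix f g assume "f - (vx + vy) * g \<in> gen2 vx vy"
      then obtain u v where "f - (vx + vy) * g = u * vx + v * vy" by (auto simp: gen2_def)
      then have "f = (u + g) * vx + (v + g) * vy" by (simp add: algebra_simps)
      then show "f \<in> gen2 vx vy" unfolding gen2_def by blast
    next
      fix f assume "f \<in> gen2 vx vy"
      then show "\<exists>g. f - (vx + vy) * g \<in> gen2 vx vy" by (intro exI[of _ 0]) simp
    qed
    then have "coset_index (xyz_ideal d1 d2 d3) = 2 ^ 1"
      by (simp add: coset_index_xyz_ideal d coset_index_vx_vy)
    from finite_dim_quot_dim_quot[OF I this] show ?thesis by (simp add: d)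
  next
    case (Suc j)
    define s :: nat where "s = 2 ^ j"
    \<comment> \<open>The lower bounds on the exponents exceed \<open>s\<close>, so none of these
      natural subtractions truncates, and \<open>c\<close> is at most \<open>s\<close>.\<close>
    define a b c where "a = d1 - s" and "b = d2 - s" and "c = q - d3"
    have qs: "q = 2 * s" by (simp add: q Suc s_def)
    have d: "d1 = s + a" "d2 = s + b" "d3 = 2 * s - c" and le: "a \<le> s" "b \<le> s" "c \<le> s"
      using assms by (simp_all add: qs a_def b_def c_def)
    have "s > 0" by (simp add: s_def)
    \<comment> \<open>Strictness makes the dimension positive, as
      \<open>finite_dim_quot_dim_quot\<close> requires, and the later natural subtraction
      exact.\<close>
    have "c * (a + b) \<le> s * (a + b)" using le by simp
    also have "\<dots> < (s + a) * (s + b)" using \<open>s > 0\<close> by (simp add: algebra_simps)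
    finally have less: "c * (a + b) < d1 * d2" by (simp add: d)
    have "coset_index (xyz_ideal d1 d2 d3) * 2 ^ (c * (a + b)) = 2 ^ (d1 * d2)"
      using coset_index_gen3_vx_vy[OF s_def le] by (simp add: coset_index_xyz_ideal d)
    also have "\<dots> = 2 ^ (d1 * d2 - c * (a + b)) * 2 ^ (c * (a + b))"
      using less by (simp add: power_add[symmetric])
    finally have "coset_index (xyz_ideal d1 d2 d3) = 2 ^ (d1 * d2 - c * (a + b))" by simp
    from finite_dim_quot_dim_quot[OF I this] less
    have fin: "finite_dim_quot (xyz_ideal d1 d2 d3)"
      and dim: "dim_quot (xyz_ideal d1 d2 d3) = d1 * d2 - c * (a + b)" by simp_all
    have d3: "int d3 = 2 * int s - int c" using le by (simp add: d)
    have "int (d1 * d2 - c * (a + b)) = int d1 * int d2 - int c * (int a + int b)"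
      using less by (simp add: of_nat_diff)
    \<comment> \<open>With c = q - d3 and a + b = d1 + d2 - q this is the expansion of d1 d2 - (q -
      d3)(d1 + d2 - q).\<close>
    also have "\<dots> = int d1 * int d2 + int d2 * int d3 + int d1 * int d3
        - int q * (int d1 + int d2 + int d3) + (int q)^2"
      unfolding d3 d(1,2) qs by (simp add: algebra_simps power2_eq_square)
    finally show ?thesis using fin dim by simp
  qed
qed

end
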